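(* Let $G=\langle a,b,t \mid t^2=1,\ ab=ba,\ a^t=b\rangle\cong\mathbb{Z}^2\rtimes\mathbb{Z}/2\mathbb{Z}$, with the generating set $Z=\{a^{\pm1},b^{\pm1},t\}$. Then $\mathsf{ConjSL}(G,Z)$ is not regular with respect to any total ordering on $Z$, but the spherical conjugacy growth series is given by the rational function \[ \widetilde{\sigma}(G,Z)=\frac{(1+z)(1+2z+3z^2-z^3-z^4)}{(1-z^2)^2}. \] Moreover, $\mathsf{ConjGeo}(G,Z)$ and (for any total ordering on $Z$) $\mathsf{ConjMinLenSL}(G,Z)$ are regular.
   Context: Here $a^t=t^{-1}at$. For $w\in Z^*$, $l(w)$ is its length and $\pi(w)$ the element of $G$ it represents. For $g\in G$, $|g|$ is the length of a shortest word over $Z$ representing $g$, and $|g|_c=\min\{|h| : h\text{ conjugate to }g\text{ in }G\}$. $\mathsf{ConjGeo}(G,Z)=\{w\in Z^* : l(w)=|\pi(w)|_c\}$. Given a total ordering of $Z$, the shortlex ordering on $Z^*$ compares words first by length and then, for equal length, lexicographically; $y_g$ denotes the shortlex least word representing $g\in G$, and $z_c$ the shortlex least word representing an element of the conjugacy class $c$. $\mathsf{ConjMinLenSL}(G,Z)=\{y_g : g\in G,\ |g|=|g|_c\}$ and $\mathsf{ConjSL}(G,Z)=\{z_c : c\text{ a conjugacy class of }G\}$. The spherical conjugacy growth series is $\widetilde{\sigma}(G,Z)=\sum_{n\ge0}\phi(n)z^n$, where $\phi(n)$ is the number of words of length $n$ in $\mathsf{ConjSL}(G,Z)$ (the number of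 conjugacy classes whose shortest elements have length $n$; this is independent of the ordering). A language is regular if it is accepted by a finite state automaton. *)

theory Defs
  imports "HOL-Algebra.Elementary_Groups" "HOL-Computational_Algebra.Formal_Power_Series"
begin

text \<open>A letter is a pair of a generator symbol and a sign; \<open>(x, True)\<close> stands for \<open>x\<close> and
  \<open>(x, False)\<close> for its formal inverse. A relation is a pair \<open>(u, v)\<close>, read as \<open>u = v\<close>.\<close>

inductive pres_eq :: "(('x \<times> bool) list \<times> ('x \<times> bool) list) set
    \<Rightarrow> ('x \<times> bool) list \<Rightarrow> ('x \<times> bool) list \<Rightarrow> bool" for R where
  pres_eq_rel: "(u, v) \<in> R \<Longrightarrow> pres_eq R u v"
| pres_eq_cancel: "pres_eq R [(x, e), (x, \<not> e)] []"
| pres_eq_refl: "pres_eq R u u"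
| pres_eq_sym: "pres_eq R u v \<Longrightarrow> pres_eq R v u"
| pres_eq_trans: "pres_eq R u v \<Longrightarrow> pres_eq R v w \<Longrightarrow> pres_eq R u w"
| pres_eq_append: "pres_eq R u u' \<Longrightarrow> pres_eq R v v' \<Longrightarrow> pres_eq R (u @ v) (u' @ v')"

definition pres_class :: "(('x \<times> bool) list \<times> ('x \<times> bool) list) set
    \<Rightarrow> ('x \<times> bool) list \<Rightarrow> ('x \<times> bool) list set" where
  "pres_class R w = {v. pres_eq R w v}"

text \<open>The generators are all elements of the type \<open>'x\<close>.\<close>

definition presented_group :: "(('x \<times> bool) list \<times> ('x \<times> bool) list) set
    \<Rightarrow> ('x \<times> bool) list set monoid" where
  "presented_group R =
     \<lparr>carrier = range (pres_class R),
      monoid.mult = (\<lambda>X Y. \<Union>u\<in>X. \<Union>v\<in>Y. pres_class R (u @ v)),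
      one = pres_class R []\<rparr>"

lemma pres_class_eq_iff: "pres_class R u = pres_class R v \<longleftrightarrow> pres_eq R u v"
  unfolding pres_class_def set_eq_iff mem_Collect_eq
  by (meson pres_eq_refl pres_eq_sym pres_eq_trans)

lemma pres_class_mult:
  "pres_class R u \<otimes>\<^bsub>presented_group R\<^esub> pres_class R v = pres_class R (u @ v)"
proof -
  have "pres_class R (u' @ v') = pres_class R (u @ v)"
    if "u' \<in> pres_class R u" "v' \<in> pres_class R v" for u' v'
    using that pres_eq_append[of R u u' v v']
    by (metis pres_class_eq_iff mem_Collect_eq pres_class_def)
  moreover have "u \<in> pres_class R u" "v \<in> pres_class R v"
    by (simp_all add: pres_class_def pres_eq_refl)
  ultimately have "(\<Union>u'\<in>pres_class R u. \<Union>v'\<in>pres_class R v. pres_class R (u' @ v')) =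
      pres_class R (u @ v)"
    by blast
  then show ?thesis
    by (simp add: presented_group_def)
qed

lemma pres_eq_inverse:
  "pres_eq R (rev (map (\<lambda>(x, e). (x, \<not> e)) w) @ w) []"
proof (induction w)
  case Nil
  show ?case by (simp add: pres_eq_refl)
next
  case (Cons l w)
  obtain x e where l: "l = (x, e)" by (cases l)
  let ?w' = "rev (map (\<lambda>(x, e). (x, \<not> e)) w)"
  have "pres_eq R [(x, \<not> e), (x, e)] []"
    using pres_eq_cancel[of R x "\<not> e"] by simp
  from pres_eq_append[OF pres_eq_refl[of R ?w'] pres_eq_append[OF this pres_eq_refl[of R w]]]
  have "pres_eq R (?w' @ [(x, \<not> e), (x, e)] @ w) (?w' @ w)"
    by simp
  then have "pres_eq R (?w' @ [(x, \<not> e), (x, e)] @ w) []"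
    using Cons.IH by (rule pres_eq_trans)
  then show ?case by (simp add: l)
qed

lemma group_presented_group: "group (presented_group R)"
proof (rule groupI)
  fix X Y W
  assume "X \<in> carrier (presented_group R)" "Y \<in> carrier (presented_group R)"
    "W \<in> carrier (presented_group R)"
  then obtain u v w where "X = pres_class R u" "Y = pres_class R v" "W = pres_class R w"
    by (auto simp: presented_group_def)
  then show "X \<otimes>\<^bsub>presented_group R\<^esub> Y \<otimes>\<^bsub>presented_group R\<^esub> W =
      X \<otimes>\<^bsub>presented_group R\<^esub> (Y \<otimes>\<^bsub>presented_group R\<^esub> W)"
    by (simp add: pres_class_mult)
next
  fix X Y
  assume "X \<in> carrier (presented_group R)" "Y \<in> carrier (presented_group R)"
  then obtain u v where "X = pres_class R u" "Y = pres_class R v"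
    by (auto simp: presented_group_def)
  then have "X \<otimes>\<^bsub>presented_group R\<^esub> Y = pres_class R (u @ v)"
    by (simp add: pres_class_mult)
  then show "X \<otimes>\<^bsub>presented_group R\<^esub> Y \<in> carrier (presented_group R)"
    by (simp add: presented_group_def)
next
  show "\<one>\<^bsub>presented_group R\<^esub> \<in> carrier (presented_group R)"
    by (simp add: presented_group_def)
next
  fix X
  assume "X \<in> carrier (presented_group R)"
  then obtain w where X: "X = pres_class R w"
    by (auto simp: presented_group_def)
  have one: "\<one>\<^bsub>presented_group R\<^esub> = pres_class R []"
    by (simp add: presented_group_def)
  show "\<one>\<^bsub>presented_group R\<^esub> \<otimes>\<^bsub>presented_group R\<^esub> X = X"
    using pres_class_mult[of R "[]" w] by (simp add: one X)
  let ?w' = "rev (map (\<lambda>(x, e). (x, \<not> e)) w)"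
  have "pres_class R ?w' \<otimes>\<^bsub>presented_group R\<^esub> X = \<one>\<^bsub>presented_group R\<^esub>"
    unfolding X one pres_class_mult pres_class_eq_iff by (rule pres_eq_inverse)
  then show "\<exists>Y\<in>carrier (presented_group R).
      Y \<otimes>\<^bsub>presented_group R\<^esub> X = \<one>\<^bsub>presented_group R\<^esub>"
    by (auto simp: presented_group_def)
qed

definition semidirect_product ::
    "('a, 'm) monoid_scheme \<Rightarrow> ('b, 'n) monoid_scheme \<Rightarrow> ('b \<Rightarrow> 'a \<Rightarrow> 'a) \<Rightarrow> ('a \<times> 'b) monoid" where
  "semidirect_product N H \<alpha> =
     \<lparr>carrier = carrier N \<times> carrier H,
      monoid.mult = (\<lambda>(n, h) (n', h'). (n \<otimes>\<^bsub>N\<^esub> \<alpha> h n', h \<otimes>\<^bsub>H\<^esub> h')),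
      one = (\<one>\<^bsub>N\<^esub>, \<one>\<^bsub>H\<^esub>)\<rparr>"

text \<open>The states of the automaton are taken from \<open>nat\<close>, which is no restriction as there are
  finitely many of them.\<close>

definition regular_language :: "'s set \<Rightarrow> 's list set \<Rightarrow> bool" where
  "regular_language A L \<longleftrightarrow>
     (\<exists>(Q :: nat set) q0 F \<delta>. finite Q \<and> q0 \<in> Q \<and> F \<subseteq> Q \<and>
        (\<forall>q\<in>Q. \<forall>x\<in>A. \<delta> q x \<in> Q) \<and>
        L = {w \<in> lists A. foldl \<delta> q0 w \<in> F})"

text \<open>In what follows the alphabet \<open>Z\<close> is a subset of the carrier of \<open>G\<close> that generates \<open>G\<close>
  and is closed under inversion. Words are elements of \<open>lists Z\<close>.\<close>

definition word_value :: "('g, 'm) monoid_scheme \<Rightarrow> 'g list \<Rightarrow> 'g" where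
  "word_value G w = foldr (\<lambda>x y. x \<otimes>\<^bsub>G\<^esub> y) w \<one>\<^bsub>G\<^esub>"

definition element_length :: "('g, 'm) monoid_scheme \<Rightarrow> 'g set \<Rightarrow> 'g \<Rightarrow> nat" where
  "element_length G Z g = (LEAST n. \<exists>w\<in>lists Z. word_value G w = g \<and> length w = n)"

definition conjugacy_class :: "('g, 'm) monoid_scheme \<Rightarrow> 'g \<Rightarrow> 'g set" where
  "conjugacy_class G g = {inv\<^bsub>G\<^esub> x \<otimes>\<^bsub>G\<^esub> g \<otimes>\<^bsub>G\<^esub> x | x. x \<in> carrier G}"

definition conj_length :: "('g, 'm) monoid_scheme \<Rightarrow> 'g set \<Rightarrow> 'g \<Rightarrow> nat" where
  "conj_length G Z g = (LEAST n. \<exists>h\<in>conjugacy_class G g. element_length G Z h = n)"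

definition ConjGeo :: "('g, 'm) monoid_scheme \<Rightarrow> 'g set \<Rightarrow> 'g list set" where
  "ConjGeo G Z = {w \<in> lists Z. length w = conj_length G Z (word_value G w)}"

text \<open>The total order \<open>r\<close> on \<open>Z\<close> is reflexive, whereas \<^const>\<open>lenlex\<close> expects a strict order.\<close>

definition shortlex_least :: "('g \<times> 'g) set \<Rightarrow> 'g list set \<Rightarrow> 'g list" where
  "shortlex_least r W = (THE w. w \<in> W \<and> (\<forall>v\<in>W. v \<noteq> w \<longrightarrow> (w, v) \<in> lenlex (r - Id)))"

definition shortlex_element ::
    "('g, 'm) monoid_scheme \<Rightarrow> 'g set \<Rightarrow> ('g \<times> 'g) set \<Rightarrow> 'g \<Rightarrow> 'g list" where
  "shortlex_element G Z r g = shortlex_least r {w \<in> lists Z. word_value G w = g}"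

definition shortlex_class ::
    "('g, 'm) monoid_scheme \<Rightarrow> 'g set \<Rightarrow> ('g \<times> 'g) set \<Rightarrow> 'g set \<Rightarrow> 'g list" where
  "shortlex_class G Z r c = shortlex_least r {w \<in> lists Z. word_value G w \<in> c}"

definition ConjMinLenSL ::
    "('g, 'm) monoid_scheme \<Rightarrow> 'g set \<Rightarrow> ('g \<times> 'g) set \<Rightarrow> 'g list set" where
  "ConjMinLenSL G Z r =
     {shortlex_element G Z r g | g. g \<in> carrier G \<and> element_length G Z g = conj_length G Z g}"

definition ConjSL ::
    "('g, 'm) monoid_scheme \<Rightarrow> 'g set \<Rightarrow> ('g \<times> 'g) set \<Rightarrow> 'g list set" where
  "ConjSL G Z r = {shortlex_class G Z r c | c. c \<in> conjugacy_class G ` carrier G}"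

definition spherical_conj_growth ::
    "('g, 'm) monoid_scheme \<Rightarrow> 'g set \<Rightarrow> ('g \<times> 'g) set \<Rightarrow> rat fps" where
  "spherical_conj_growth G Z r = Abs_fps (\<lambda>n. of_nat (card {w \<in> ConjSL G Z r. length w = n}))"

datatype gen = Gen_a | Gen_b | Gen_t

text \<open>\<open>t\<^sup>2 = 1\<close>, \<open>a b = b a\<close>, \<open>t\<^sup>-\<^sup>1 a t = b\<close>\<close>

definition relations :: "((gen \<times> bool) list \<times> (gen \<times> bool) list) set" where
  "relations =
     {([(Gen_t, True), (Gen_t, True)], []),
      ([(Gen_a, True), (Gen_b, True)], [(Gen_b, True), (Gen_a, True)]),
      ([(Gen_t, False), (Gen_a, True), (Gen_t, True)], [(Gen_b, True)])}"

definition GG :: "(gen \<times> bool) list set monoid" where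
  "GG = presented_group relations"

definition gen_elt :: "gen \<Rightarrow> (gen \<times> bool) list set" where
  "gen_elt x = pres_class relations [(x, True)]"

definition ZZ :: "(gen \<times> bool) list set set" where
  "ZZ = {gen_elt Gen_a, inv\<^bsub>GG\<^esub> gen_elt Gen_a, gen_elt Gen_b, inv\<^bsub>GG\<^esub> gen_elt Gen_b, gen_elt Gen_t}"

definition swap_action :: "int \<Rightarrow> int \<times> int \<Rightarrow> int \<times> int" where
  "swap_action k = (\<lambda>(i, j). if k = 0 then (i, j) else (j, i))"

lemma group_GG: "group GG"
  unfolding GG_def by (rule group_presented_group)

lemma gen_elt_carrier: "gen_elt x \<in> carrier GG"
  by (simp add: gen_elt_def GG_def presented_group_def)

lemma ZZ_generates: "generate GG ZZ = carrier GG"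
proof
  interpret group GG by (rule group_GG)
  have "ZZ \<subseteq> carrier GG"
    by (auto simp: ZZ_def gen_elt_carrier)
  then show "generate GG ZZ \<subseteq> carrier GG"
    by (rule generate_incl)
  have letter: "pres_class relations [(x, e)] \<in> generate GG ZZ" for x e
  proof -
    have x: "gen_elt x \<in> ZZ" by (cases x) (auto simp: ZZ_def)
    have "pres_class relations [(x, False)] \<otimes>\<^bsub>GG\<^esub> gen_elt x = \<one>\<^bsub>GG\<^esub>"
      using pres_eq_cancel[of relations x False]
      by (simp add: gen_elt_def GG_def pres_class_mult pres_class_eq_iff)
        (simp add: presented_group_def pres_class_eq_iff)
    then have "inv\<^bsub>GG\<^esub> gen_elt x = pres_class relations [(x, False)]"
      by (intro inv_equality) (simp_all add: gen_elt_carrier, simp add: GG_def presented_group_def)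
    then show ?thesis
      using generate.inv[OF x, of GG] generate.incl[OF x, of GG]
      by (cases e) (simp_all add: gen_elt_def)
  qed
  have "pres_class relations w \<in> generate GG ZZ" for w
  proof (induction w)
    case Nil
    then show ?case
      using generate.one[of GG ZZ] by (simp add: GG_def presented_group_def)
  next
    case (Cons l w)
    obtain x e where "l = (x, e)" by (cases l)
    then show ?case
      using generate.eng[OF letter[of x e] Cons.IH]
      by (simp add: GG_def pres_class_mult)
  qed
  then show "carrier GG \<subseteq> generate GG ZZ"
    by (auto simp: GG_def presented_group_def)
qed

end

(* An element is given by coordinates (i, j, e), standing for a^i b^j t^e. Then (i, j, 0) is
   conjugate to (j, i, 0) only, and (i, j, 1) to all (k, l, 1) with k + l = i + j; the lengths are
   |i| + |j| + e, and the conjugacy lengths |i| + |j| and |i + j| + 1. Whether a letter put in front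
   of a word of ConjGeo yields a word of ConjGeo, and which letters start a geodesic word for an
   element, depends only on e and the signs of i and j. So ConjGeo is recognised by reading words
   from right to left while remembering e and the two signs, and so is ConjMinLenSL, whose words
   are those that have at each suffix the least possible first letter.

   If x < y are a and b in their order, then x^n y^n is in ConjSL, but for i < j the word x^i y^j is
   not, as the conjugate x^j y^i precedes it; hence ConjSL is not regular. The growth series is
   found by counting the unordered pairs {i, j} and the values of i + j of given length. *)
theory Submission
  imports Defs
begin

section \<open>Regular languages\<close>

text \<open>Since the hypothesis is a congruence for adding letters on the left whereas automata read
  from left to right, the states of the automaton are the maps \<open>f s \<mapsto> f (w @ s)\<close>.\<close>

lemma regular_language_left_congruence:
  fixes f :: "'s list \<Rightarrow> 'b"
  assumes fin: "finite (f ` lists A)"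
    and cong: "\<And>x u v. \<lbrakk>x \<in> A; u \<in> lists A; v \<in> lists A; f u = f v\<rbrakk> \<Longrightarrow> f (x # u) = f (x # v)"
    and sub: "L \<subseteq> lists A"
    and sat: "\<And>u v. \<lbrakk>u \<in> L; v \<in> lists A; f u = f v\<rbrakk> \<Longrightarrow> v \<in> L"
  shows "regular_language A L"
proof -
  \<comment> \<open>A map on the finite image of \<open>f\<close>, stored as its graph; only
    finitely many such graphs exist.\<close>
  define F where "F w = (\<lambda>s. (f s, f (w @ s))) ` lists A" for w
  have "F w \<subseteq> f ` lists A \<times> f ` lists A" if "w \<in> lists A" for w
    using that by (auto simp: F_def intro!: imageI)
  then have "F ` lists A \<subseteq> Pow (f ` lists A \<times> f ` lists A)"
    by blast
  with fin have finF: "finite (F ` lists A)"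
    by (meson finite_Pow_iff finite_SigmaI finite_subset)
  have app: "f (w @ s) = f (w @ s')"
    if "w \<in> lists A" "s \<in> lists A" "s' \<in> lists A" "f s = f s'" for w s s'
    using that by (induction w) (auto intro!: cong)
  have Fapp: "f (u @ s) = f (v @ s)"
    if u: "u \<in> lists A" and v: "v \<in> lists A" and s: "s \<in> lists A" and eq: "F u = F v" for u v s
  proof -
    have "(f s, f (u @ s)) \<in> F v"
      using s unfolding eq[symmetric] by (auto simp: F_def)
    then obtain s' where "s' \<in> lists A" "f s = f s'" "f (u @ s) = f (v @ s')"
      unfolding F_def by blast
    with app[OF v _ s] show ?thesis by metis
  qed
  \<comment> \<open>Reading \<open>x\<close> is well defined on states since
    \<open>(u @ [x]) @ s\<close> is \<open>u @ (x # s)\<close>.\<close>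
  have Fsnoc: "F (u @ [x]) = F (v @ [x])"
    if "u \<in> lists A" "v \<in> lists A" "x \<in> A" "F u = F v" for u v x
  proof -
    have "f (u @ x # s) = f (v @ x # s)" if "s \<in> lists A" for s
      using Fapp[of u v "x # s"] that \<open>u \<in> lists A\<close> \<open>v \<in> lists A\<close> \<open>x \<in> A\<close> \<open>F u = F v\<close> by simp
    then show ?thesis by (auto simp: F_def)
  qed
  obtain g :: "'b rel \<Rightarrow> nat" where g: "inj_on g (F ` lists A)"
    using finite_imp_inj_to_nat_seg[OF finF] by metis
  define rep where "rep q = (SOME u. u \<in> lists A \<and> g (F u) = q)" for q
  define \<delta> where "\<delta> q x = g (F (rep q @ [x]))" for q x
  have rep: "rep (g (F u)) \<in> lists A \<and> F (rep (g (F u))) = F u" if "u \<in> lists A" for u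
  proof -
    have "rep (g (F u)) \<in> lists A \<and> g (F (rep (g (F u)))) = g (F u)"
      unfolding rep_def by (rule someI) (use that in simp)
    with g that show ?thesis by (auto dest: inj_onD)
  qed
  have \<delta>: "\<delta> (g (F u)) x = g (F (u @ [x]))" if "u \<in> lists A" "x \<in> A" for u x
    using rep[OF that(1)] Fsnoc[of "rep (g (F u))" u x] that by (simp add: \<delta>_def)
  have run: "foldl \<delta> (g (F [])) w = g (F w)" if "w \<in> lists A" for w
    using that by (induction w rule: rev_induct) (auto simp: \<delta>)
  \<comment> \<open>The value of the map at the empty word is \<open>f w\<close>, which decides
    membership in \<open>L\<close>.\<close>
  have acc: "g (F w) \<in> (\<lambda>u. g (F u)) ` L \<longleftrightarrow> w \<in> L" if w: "w \<in> lists A" for w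
  proof
    assume "g (F w) \<in> (\<lambda>u. g (F u)) ` L"
    then obtain u where u: "u \<in> L" "g (F w) = g (F u)" by auto
    then have "F u = F w"
      using g w sub by (metis image_eqI inj_onD subsetD)
    then have "f u = f w"
      using Fapp[of u w "[]"] u sub w by auto
    with u w show "w \<in> L" by (auto intro: sat)
  qed auto
  show ?thesis
    unfolding regular_language_def
  proof (intro exI conjI ballI)
    show "finite (g ` F ` lists A)" using finF by simp
    show "g (F []) \<in> g ` F ` lists A" by auto
    show "(\<lambda>u. g (F u)) ` L \<subseteq> g ` F ` lists A" using sub by auto
    show "\<delta> q x \<in> g ` F ` lists A" if "q \<in> g ` F ` lists A" "x \<in> A" for q x
    proof -
      obtain u where "u \<in> lists A" "q = g (F u)" using \<open>q \<in> g ` F ` lists A\<close> by auto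
      then show ?thesis using that \<delta>[of u x] by auto
    qed
    show "L = {w \<in> lists A. foldl \<delta> (g (F [])) w \<in> (\<lambda>u. g (F u)) ` L}"
    proof (rule Set.set_eqI)
      fix w
      show "w \<in> L \<longleftrightarrow> w \<in> {w \<in> lists A. foldl \<delta> (g (F [])) w \<in> (\<lambda>u. g (F u)) ` L}"
        using run[of w] acc[of w] sub by (cases "w \<in> lists A") auto
    qed
  qed
qed

text \<open>Pigeonhole: finitely many states serve all powers of \<open>x\<close>, so
  \<open>x^i\<close> and \<open>x^j\<close> with i < j lead to the same state, and
  \<open>x^i\<close> may replace \<open>x^j\<close> in the accepted word
  \<open>x^j y^j\<close>.\<close>

lemma regular_language_pumping:
  assumes reg: "regular_language A L" and "x \<in> A" "y \<in> A"
    and diag: "\<And>n. replicate n x @ replicate n y \<in> L"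
  shows "\<exists>i j. i < j \<and> replicate i x @ replicate j y \<in> L"
proof -
  obtain Q :: "nat set" and q0 F \<delta> where Q: "finite Q" "q0 \<in> Q" "\<forall>q\<in>Q. \<forall>x\<in>A. \<delta> q x \<in> Q"
    and L: "L = {w \<in> lists A. foldl \<delta> q0 w \<in> F}"
    using reg unfolding regular_language_def by auto
  have lists: "replicate n x \<in> lists A" "replicate n y \<in> lists A" for n
    using assms by (auto simp: in_lists_conv_set)
  define s where "s n = foldl \<delta> q0 (replicate n x)" for n
  have "s n \<in> Q" for n
  proof (induction n)
    case (Suc n)
    then show ?case
      using Q \<open>x \<in> A\<close> by (simp add: s_def flip: replicate_append_same)
  qed (use Q in \<open>simp add: s_def\<close>)
  then have "finite (range s)"
    using Q by (meson finite_subset image_subsetI)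
  then have "\<not> inj s"
    using finite_imageD infinite_UNIV_nat by blast
  then obtain i j where ij: "i < j" "s i = s j"
    by (metis injI linorder_neqE_nat)
  have "foldl \<delta> q0 (replicate i x @ replicate j y) = foldl \<delta> q0 (replicate j x @ replicate j y)"
    using ij by (simp add: s_def)
  moreover have "foldl \<delta> q0 (replicate j x @ replicate j y) \<in> F"
    using diag[of j] by (simp add: L)
  ultimately show ?thesis
    using ij(1) lists unfolding L by force
qed

section \<open>Shortlex orderings\<close>

lemma lenlex_linear:
  assumes "total_on A r" "u \<in> lists A" "v \<in> lists A" "u \<noteq> v"
  shows "(u, v) \<in> lenlex (r - Id) \<or> (v, u) \<in> lenlex (r - Id)"
proof (cases "length u = length v")
  case True
  then obtain p x s y s' where xy: "x \<noteq> y" "u = p @ [x] @ s" "v = p @ [y] @ s'"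
    using same_length_different assms by blast
  then have "(x, y) \<in> r \<or> (y, x) \<in> r"
    using assms by (auto simp: total_on_def)
  then show ?thesis
    using xy True by (auto simp: irrefl_def Cons_lenlex_iff)
qed (auto simp: lenlex_conv)

text \<open>Finiteness of \<open>A\<close> makes the strict part of \<open>r\<close> well-founded,
  hence also \<open>lenlex\<close>. A minimal word of \<open>W\<close> is least by totality, so the
  description in \<open>shortlex_least\<close> has exactly one solution.\<close>

lemma
  assumes r: "linear_order_on A r" and "finite A" and W: "W \<subseteq> lists A" "W \<noteq> {}"
  shows shortlex_least_in: "shortlex_least r W \<in> W"
    and shortlex_least_less: "\<And>v. v \<in> W \<Longrightarrow> v \<noteq> shortlex_least r W \<Longrightarrow>
      (shortlex_least r W, v) \<in> lenlex (r - Id)"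
proof -
  have "r \<subseteq> A \<times> A" and tot: "total_on A r"
    using r by (auto simp: order_on_defs)
  then have "finite r"
    using \<open>finite A\<close> by (meson finite_SigmaI finite_subset)
  then have "wf (r - Id)"
    using r linear_order_on_well_order_on well_order_on_def by blast
  then have wf: "wf (lenlex (r - Id))" by blast
  let ?P = "\<lambda>w. w \<in> W \<and> (\<forall>v\<in>W. v \<noteq> w \<longrightarrow> (w, v) \<in> lenlex (r - Id))"
  obtain w where w: "w \<in> W" "\<And>v. (v, w) \<in> lenlex (r - Id) \<Longrightarrow> v \<notin> W"
    using wfE_min[OF wf] W(2) by (metis all_not_in_conv)
  then have "?P w"
    using lenlex_linear[OF tot] W(1) by (metis subsetD)
  moreover have uniq: "w = w'" if "?P w" "?P w'" for w w'
    using that wf_not_sym[OF wf] by metis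
  ultimately have "\<exists>!w. ?P w"
    by blast
  then have "?P (shortlex_least r W)"
    unfolding shortlex_least_def by (rule theI')
  then show "shortlex_least r W \<in> W"
    and "\<And>v. v \<in> W \<Longrightarrow> v \<noteq> shortlex_least r W \<Longrightarrow> (shortlex_least r W, v) \<in> lenlex (r - Id)"
    by auto
qed

section \<open>Coordinates\<close>

type_synonym coord = "int \<times> int \<times> bool"

text \<open>In the product of a^i b^j t^e and a^k b^l t^f, moving t across a^k b^l interchanges k
  and l.\<close>

fun cmul :: "coord \<Rightarrow> coord \<Rightarrow> coord" where
  "cmul (i, j, e) (k, l, f) = (if e then (i + l, j + k, \<not> f) else (i + k, j + l, f))"

lemma cmul_assoc: "cmul (cmul c d) e = cmul c (cmul d e)"
  by (cases c; cases d; cases e) auto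

lemma cmul_one: "cmul (0, 0, False) c = c" "cmul c (0, 0, False) = c"
  by (cases c; auto)+

text \<open>The sign of \<open>Gen_t\<close> is ignored because t is its own inverse.\<close>

fun gen_coord :: "gen \<times> bool \<Rightarrow> coord" where
  "gen_coord (Gen_a, s) = (if s then 1 else - 1, 0, False)"
| "gen_coord (Gen_b, s) = (0, if s then 1 else - 1, False)"
| "gen_coord (Gen_t, s) = (0, 0, True)"

definition free_coord :: "(gen \<times> bool) list \<Rightarrow> coord" where
  "free_coord w = foldr (\<lambda>l. cmul (gen_coord l)) w (0, 0, False)"

lemma free_coord_simps [simp]:
  "free_coord [] = (0, 0, False)"
  "free_coord (l # w) = cmul (gen_coord l) (free_coord w)"
  by (simp_all add: free_coord_def)

lemma free_coord_append: "free_coord (u @ v) = cmul (free_coord u) (free_coord v)"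
  by (induction u) (simp_all add: cmul_assoc cmul_one)

text \<open>The defining relations and free cancellation hold under \<open>cmul\<close>, so
  coordinates descend from words to \<open>GG\<close>.\<close>

lemma free_coord_cong: "pres_eq relations u v \<Longrightarrow> free_coord u = free_coord v"
proof (induction rule: pres_eq.induct)
  case (pres_eq_cancel x e)
  then show ?case by (cases x) auto
qed (auto simp: relations_def free_coord_append)

text \<open>On the elements of \<open>GG\<close> the choice of a representative is immaterial, by
  \<open>free_coord_cong\<close>.\<close>

definition coord :: "(gen \<times> bool) list set \<Rightarrow> coord" where
  "coord X = free_coord (SOME w. w \<in> X)"

lemma coord_pres_class: "coord (pres_class relations w) = free_coord w"
proof -
  have "(SOME v. v \<in> pres_class relations w) \<in> pres_class relations w"
    by (rule someI[of _ w]) (simp add: pres_class_def pres_eq_refl)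
  then show ?thesis
    by (simp add: coord_def pres_class_def free_coord_cong)
qed

lemma GG_simps:
  "carrier GG = range (pres_class relations)"
  "\<one>\<^bsub>GG\<^esub> = pres_class relations []"
  "pres_class relations u \<otimes>\<^bsub>GG\<^esub> pres_class relations v = pres_class relations (u @ v)"
  by (simp_all add: GG_def pres_class_mult) (simp_all add: presented_group_def)

interpretation GG: group GG
  by (rule group_GG)

lemma coord_one: "coord \<one>\<^bsub>GG\<^esub> = (0, 0, False)"
  by (simp add: GG_simps coord_pres_class)

lemma coord_mult:
  "\<lbrakk>x \<in> carrier GG; y \<in> carrier GG\<rbrakk> \<Longrightarrow> coord (x \<otimes>\<^bsub>GG\<^esub> y) = cmul (coord x) (coord y)"
  by (auto simp: GG_simps(1)) (simp add: GG_simps(3) coord_pres_class free_coord_append)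

text \<open>Serves both for commuting powers and for moving t past powers of a or b. Negative powers
  are natural powers of the inverses, which satisfy a relation of the same form.\<close>

lemma (in group) int_pow_intertwine:
  fixes k :: int
  assumes "x \<in> carrier G" "x' \<in> carrier G" "y \<in> carrier G" and "x \<otimes> y = y \<otimes> x'"
  shows "x [^] k \<otimes> y = y \<otimes> x' [^] k"
proof -
  have nat: "u [^] n \<otimes> y = y \<otimes> u' [^] n"
    if "u \<in> carrier G" "u' \<in> carrier G" "u \<otimes> y = y \<otimes> u'" for u u' and n :: nat
    using that assms(3) by (induction n) (simp_all, metis m_assoc nat_pow_closed)
  have "inv x \<otimes> y = y \<otimes> inv x'"
    using assms by (metis inv_closed inv_solve_left inv_solve_right m_assoc m_closed)
  then have "inv x [^] nat (- k) \<otimes> y = y \<otimes> inv x' [^] nat (- k)"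
    by (intro nat) (use assms in auto)
  moreover have "x [^] nat k \<otimes> y = y \<otimes> x' [^] nat k"
    by (intro nat) (use assms in auto)
  ultimately show ?thesis
    unfolding int_pow_def2 nat_pow_inv[OF assms(1)] nat_pow_inv[OF assms(2)] by presburger
qed

section \<open>Normal forms a^i b^j t^e\<close>

lemma inv_gen_elt: "inv\<^bsub>GG\<^esub> gen_elt x = pres_class relations [(x, False)]"
proof (rule GG.inv_equality)
  show "pres_class relations [(x, False)] \<otimes>\<^bsub>GG\<^esub> gen_elt x = \<one>\<^bsub>GG\<^esub>"
    using pres_eq_cancel[of relations x False]
    by (simp add: gen_elt_def GG_simps pres_class_eq_iff)
qed (simp_all add: gen_elt_carrier, simp add: GG_simps)

text \<open>Written as an integer power, a letter can be absorbed into the powers of a normal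
  form.\<close>

lemma pres_class_letter:
  "pres_class relations [(x, s)] = gen_elt x [^]\<^bsub>GG\<^esub> (if s then 1 else - 1 :: int)"
  by (simp add: GG.int_pow_neg gen_elt_carrier inv_gen_elt) (simp add: gen_elt_def)

lemma GG_relations:
  "gen_elt Gen_t \<otimes>\<^bsub>GG\<^esub> gen_elt Gen_t = \<one>\<^bsub>GG\<^esub>"
  "gen_elt Gen_b \<otimes>\<^bsub>GG\<^esub> gen_elt Gen_a = gen_elt Gen_a \<otimes>\<^bsub>GG\<^esub> gen_elt Gen_b"
  "gen_elt Gen_a \<otimes>\<^bsub>GG\<^esub> gen_elt Gen_t = gen_elt Gen_t \<otimes>\<^bsub>GG\<^esub> gen_elt Gen_b"
  "gen_elt Gen_b \<otimes>\<^bsub>GG\<^esub> gen_elt Gen_t = gen_elt Gen_t \<otimes>\<^bsub>GG\<^esub> gen_elt Gen_a"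
proof -
  note [simp] = gen_elt_carrier
  let ?a = "gen_elt Gen_a" and ?b = "gen_elt Gen_b" and ?t = "gen_elt Gen_t"
  show tt: "?t \<otimes>\<^bsub>GG\<^esub> ?t = \<one>\<^bsub>GG\<^esub>"
    unfolding gen_elt_def GG_simps pres_class_eq_iff by (rule pres_eq_rel) (simp add: relations_def)
  show "?b \<otimes>\<^bsub>GG\<^esub> ?a = ?a \<otimes>\<^bsub>GG\<^esub> ?b"
    unfolding gen_elt_def GG_simps pres_class_eq_iff
    by (rule pres_eq_sym, rule pres_eq_rel) (simp add: relations_def)
  \<comment> \<open>The third relation uses the formal inverse of t, which t^2 = 1 identifies with
    t.\<close>
  have t: "pres_class relations [(Gen_t, False)] = ?t"
    unfolding inv_gen_elt[symmetric] by (rule GG.inv_equality) (simp_all add: tt)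
  have "pres_class relations [(Gen_t, False)] \<otimes>\<^bsub>GG\<^esub> (?a \<otimes>\<^bsub>GG\<^esub> ?t) = ?b"
    unfolding gen_elt_def GG_simps pres_class_eq_iff by (rule pres_eq_rel) (simp add: relations_def)
  then have *: "?t \<otimes>\<^bsub>GG\<^esub> (?a \<otimes>\<^bsub>GG\<^esub> ?t) = ?b"
    by (simp add: t)
  have "?t \<otimes>\<^bsub>GG\<^esub> (?t \<otimes>\<^bsub>GG\<^esub> (?a \<otimes>\<^bsub>GG\<^esub> ?t)) = ?a \<otimes>\<^bsub>GG\<^esub> ?t"
    by (simp add: tt flip: GG.m_assoc)
  then show "?a \<otimes>\<^bsub>GG\<^esub> ?t = ?t \<otimes>\<^bsub>GG\<^esub> ?b"
    unfolding * by simp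
  show "?b \<otimes>\<^bsub>GG\<^esub> ?t = ?t \<otimes>\<^bsub>GG\<^esub> ?a"
    by (simp add: GG.m_assoc tt flip: *)
qed

definition normal_form :: "coord \<Rightarrow> (gen \<times> bool) list set" where
  "normal_form = (\<lambda>(i, j, e). gen_elt Gen_a [^]\<^bsub>GG\<^esub> i \<otimes>\<^bsub>GG\<^esub> (gen_elt Gen_b [^]\<^bsub>GG\<^esub> j \<otimes>\<^bsub>GG\<^esub>
     (if e then gen_elt Gen_t else \<one>\<^bsub>GG\<^esub>)))"

text \<open>The letter is moved into its place: a power of a joins a^i, a power of b first passes
  a^i, and t turns a^i b^j into b^i a^j on its way to the right end.\<close>

lemma normal_form_letter:
  "pres_class relations [l] \<otimes>\<^bsub>GG\<^esub> normal_form c = normal_form (cmul (gen_coord l) c)"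
proof -
  note [simp] = gen_elt_carrier
  let ?a = "gen_elt Gen_a" and ?b = "gen_elt Gen_b" and ?t = "gen_elt Gen_t"
  obtain x s where l: "l = (x, s)" by (cases l)
  obtain i j e where c: "c = (i, j, e)" by (cases c)
  define T where "T = (if e then ?t else \<one>\<^bsub>GG\<^esub>)"
  have T [simp]: "T \<in> carrier GG" by (simp add: T_def)
  have tT: "?t \<otimes>\<^bsub>GG\<^esub> T = (if \<not> e then ?t else \<one>\<^bsub>GG\<^esub>)"
    by (simp add: T_def GG_relations)
  note pow = GG.int_pow_intertwine[symmetric]
  have ta: "?t \<otimes>\<^bsub>GG\<^esub> (?a [^]\<^bsub>GG\<^esub> m \<otimes>\<^bsub>GG\<^esub> y) = ?b [^]\<^bsub>GG\<^esub> m \<otimes>\<^bsub>GG\<^esub> (?t \<otimes>\<^bsub>GG\<^esub> y)"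
    and tb: "?t \<otimes>\<^bsub>GG\<^esub> (?b [^]\<^bsub>GG\<^esub> m \<otimes>\<^bsub>GG\<^esub> y) = ?a [^]\<^bsub>GG\<^esub> m \<otimes>\<^bsub>GG\<^esub> (?t \<otimes>\<^bsub>GG\<^esub> y)"
    if [simp]: "y \<in> carrier GG" for m :: int and y
    using pow[of ?b ?a ?t m] pow[of ?a ?b ?t m]
    by (simp_all add: GG_relations flip: GG.m_assoc)
  have ba: "?b [^]\<^bsub>GG\<^esub> k \<otimes>\<^bsub>GG\<^esub> (?a [^]\<^bsub>GG\<^esub> m \<otimes>\<^bsub>GG\<^esub> y) = ?a [^]\<^bsub>GG\<^esub> m \<otimes>\<^bsub>GG\<^esub> (?b [^]\<^bsub>GG\<^esub> k \<otimes>\<^bsub>GG\<^esub> y)"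
    if [simp]: "y \<in> carrier GG" for k m :: int and y
  proof -
    have "?b \<otimes>\<^bsub>GG\<^esub> ?a [^]\<^bsub>GG\<^esub> m = ?a [^]\<^bsub>GG\<^esub> m \<otimes>\<^bsub>GG\<^esub> ?b"
      by (rule pow) (simp_all add: GG_relations)
    from GG.int_pow_intertwine[OF _ _ _ this, of k] show ?thesis
      by (simp flip: GG.m_assoc)
  qed
  have add: "z [^]\<^bsub>GG\<^esub> k \<otimes>\<^bsub>GG\<^esub> (z [^]\<^bsub>GG\<^esub> m \<otimes>\<^bsub>GG\<^esub> y) = z [^]\<^bsub>GG\<^esub> (k + m) \<otimes>\<^bsub>GG\<^esub> y"
    if "z \<in> carrier GG" "y \<in> carrier GG" for z y and k m :: int
    using that by (simp add: GG.int_pow_mult GG.m_assoc)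
  have nf: "normal_form c = ?a [^]\<^bsub>GG\<^esub> i \<otimes>\<^bsub>GG\<^esub> (?b [^]\<^bsub>GG\<^esub> j \<otimes>\<^bsub>GG\<^esub> T)"
    by (simp add: normal_form_def c T_def)
  show ?thesis
  proof (cases x)
    case Gen_a
    then show ?thesis
      unfolding nf l pres_class_letter by (simp add: c add normal_form_def flip: T_def)
  next
    case Gen_b
    then show ?thesis
      unfolding nf l pres_class_letter by (simp add: c add ba normal_form_def flip: T_def)
  next
    case Gen_t
    have "?t [^]\<^bsub>GG\<^esub> (if s then 1 else - 1 :: int) = ?t"
      by (simp add: GG.int_pow_neg GG.inv_equality GG_relations)
    with Gen_t show ?thesis
      unfolding nf l pres_class_letter by (simp add: c ta tb tT ba normal_form_def)
  qed
qed

text \<open>A word built up from the right stays equal to the normal form of its coordinates. Hence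
  \<open>coord\<close> is injective on \<open>GG\<close>.\<close>

lemma normal_form_coord: "g \<in> carrier GG \<Longrightarrow> normal_form (coord g) = g"
proof -
  have "normal_form (free_coord w) = pres_class relations w" for w
  proof (induction w)
    case Nil
    then show ?case by (simp add: normal_form_def gen_elt_carrier flip: GG_simps(2))
  next
    case (Cons l w)
    then show ?case
      by (simp flip: normal_form_letter) (simp add: GG_simps)
  qed
  then show "g \<in> carrier GG \<Longrightarrow> normal_form (coord g) = g"
    by (auto simp: GG_simps coord_pres_class)
qed

lemma coord_eq_iff: "\<lbrakk>g \<in> carrier GG; h \<in> carrier GG\<rbrakk> \<Longrightarrow> coord g = coord h \<longleftrightarrow> g = h"
  by (metis normal_form_coord)

lemma coord_gen:
  "coord (gen_elt Gen_a) = (1, 0, False)" "coord (inv\<^bsub>GG\<^esub> gen_elt Gen_a) = (- 1, 0, False)"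
  "coord (gen_elt Gen_b) = (0, 1, False)" "coord (inv\<^bsub>GG\<^esub> gen_elt Gen_b) = (0, - 1, False)"
  "coord (gen_elt Gen_t) = (0, 0, True)"
  unfolding inv_gen_elt by (simp_all add: gen_elt_def coord_pres_class)

section \<open>Word length and conjugacy length\<close>

definition letter_coords :: "coord set" where
  "letter_coords = {(1, 0, False), (- 1, 0, False), (0, 1, False), (0, - 1, False), (0, 0, True)}"

fun coord_length :: "coord \<Rightarrow> nat" where
  "coord_length (i, j, e) = nat \<bar>i\<bar> + nat \<bar>j\<bar> + of_bool e"

fun coord_conj_length :: "coord \<Rightarrow> nat" where
  "coord_conj_length (i, j, e) = (if e then Suc (nat \<bar>i + j\<bar>) else nat \<bar>i\<bar> + nat \<bar>j\<bar>)"

text \<open>Whether the letter with the first coordinates starts a geodesic word for the element with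
  the second coordinates.\<close>

fun descent :: "coord \<Rightarrow> coord \<Rightarrow> bool" where
  "descent (k, l, f) (i, j, e) = (if f then e else 0 < k * i \<or> 0 < l * j)"

fun coord_sgn :: "coord \<Rightarrow> coord" where
  "coord_sgn (i, j, e) = (sgn i, sgn j, e)"

fun coord_conj :: "coord \<Rightarrow> coord \<Rightarrow> bool" where
  "coord_conj (i, j, e) (k, l, f) \<longleftrightarrow>
     e = f \<and> (if e then i + j = k + l else (k, l) = (i, j) \<or> (k, l) = (j, i))"

lemma coord_length_cmul_le:
  "q \<in> letter_coords \<Longrightarrow> coord_length (cmul q c) \<le> Suc (coord_length c)"
  by (cases c) (auto simp: letter_coords_def)

lemma descent_iff:
  assumes "q \<in> letter_coords"
  shows "descent q c \<longleftrightarrow> (\<exists>d. cmul q d = c \<and> coord_length c = Suc (coord_length d))"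
proof -
  obtain i j e where c: "c = (i, j, e)" by (cases c)
  obtain k l f where q: "q = (k, l, f)" by (cases q)
  show ?thesis
  proof
    assume "descent q c"
    \<comment> \<open>The witness is the inverse of \<open>q\<close> times \<open>c\<close>; for t
      this swaps the exponents and toggles \<open>e\<close>.\<close>
    then show "\<exists>d. cmul q d = c \<and> coord_length c = Suc (coord_length d)"
      using assms
      by (intro exI[of _ "if f then (j, i, \<not> e) else (i - k, j - l, e)"])
        (auto simp: c q letter_coords_def)
  next
    assume "\<exists>d. cmul q d = c \<and> coord_length c = Suc (coord_length d)"
    then show "descent q c"
      using assms by (cases e) (auto simp: c q letter_coords_def split: if_splits)
  qed
qed

lemma exists_descent: "c \<noteq> (0, 0, False) \<Longrightarrow> \<exists>q\<in>letter_coords. descent q c"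
  by (cases c) (auto simp: letter_coords_def)

text \<open>The right side is conjugation of \<open>c\<close> by \<open>x\<close>, cleared of the
  inverse.\<close>

lemma coord_conj_iff: "coord_conj c d \<longleftrightarrow> (\<exists>x. cmul x d = cmul c x)"
proof -
  obtain i j e where c: "c = (i, j, e)" by (cases c)
  obtain k l f where d: "d = (k, l, f)" by (cases d)
  show ?thesis
  proof
    assume cd: "coord_conj c d"
    \<comment> \<open>If \<open>e\<close> holds, conjugation by a power of a shifts weight between
      the two exponents; otherwise the conjugator is t or 1, according to whether the exponents have
      to be swapped.\<close>
    then have "cmul (if e then (i - k, 0, False) else (0, 0, (k, l) \<noteq> (i, j))) d =
        cmul c (if e then (i - k, 0, False) else (0, 0, (k, l) \<noteq> (i, j)))"
      by (auto simp: c d split: if_splits)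
    then show "\<exists>x. cmul x d = cmul c x" ..
  next
    assume "\<exists>x. cmul x d = cmul c x"
    then show "coord_conj c d"
      by (auto simp: c d split: if_splits)
  qed
qed

text \<open>With t present, conjugation keeps the sum of the exponents and the triangle inequality
  applies; without t it only permutes them.\<close>

lemma coord_conj_length_le: "coord_conj c d \<Longrightarrow> coord_conj_length c \<le> coord_length d"
  by (cases c; cases d) (auto split: if_splits)

lemma coord_conj_length_attained: "\<exists>d. coord_conj c d \<and> coord_length d = coord_conj_length c"
proof -
  obtain i j e where c: "c = (i, j, e)" by (cases c)
  \<comment> \<open>With one exponent 0 the triangle inequality becomes an equality.\<close>
  show ?thesis
    by (rule exI[of _ "if e then (i + j, 0, e) else c"]) (simp add: c)
qed

lemma coord_conj_refl: "coord_conj c c"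
  by (cases c) auto

section \<open>What the signs of the exponents determine\<close>

lemma descent_sgn_cong: "coord_sgn c = coord_sgn d \<Longrightarrow> descent q c = descent q d"
  by (cases c; cases d; cases q) (auto simp: zero_less_mult_iff sgn_if split: if_splits)

lemma coord_conj_length_le_self: "coord_conj_length c \<le> coord_length c"
  by (rule coord_conj_length_le) (rule coord_conj_refl)

text \<open>The first bound can fail only for t in front of an element with t: the result has
  conjugacy length |i| + |j|, which may exceed |i + j| + 1 by any amount but is below the length |i|
  + |j| + 1 of \<open>d\<close>.\<close>

lemma coord_conj_length_cmul_le:
  assumes "q \<in> letter_coords"
  shows "coord_conj_length (cmul q d) \<le> Suc (coord_conj_length d) \<or>
    coord_conj_length (cmul q d) \<le> coord_length d"
proof -
  obtain i j e where "d = (i, j, e)" by (cases d)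
  with assms show ?thesis
    by (cases e) (auto simp: letter_coords_def, linarith)
qed

text \<open>With \<open>d\<close> the value of a word of length \<open>n\<close>, this makes
  \<open>ConjGeo\<close> closed under suffixes. The bound on \<open>coord_length d\<close> excludes
  the second alternative of \<open>coord_conj_length_cmul_le\<close>, so \<open>n\<close> is at most
  the conjugacy length of \<open>d\<close>, hence at most its length.\<close>

lemma coord_conj_length_step:
  assumes "q \<in> letter_coords" "coord_length d \<le> n" "coord_conj_length (cmul q d) = Suc n"
  shows "coord_conj_length d = n" "coord_length d = n"
  using assms coord_conj_length_cmul_le[of q d] coord_conj_length_le_self[of d] by auto

text \<open>Equality in the triangle inequality means that i and j do not have opposite
  signs.\<close>

lemma coord_geodesic_iff:
  "coord_conj_length (i, j, e) = coord_length (i, j, e) \<longleftrightarrow> e \<longrightarrow> 0 \<le> i * j"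
proof -
  have "nat \<bar>i + j\<bar> = nat \<bar>i\<bar> + nat \<bar>j\<bar> \<longleftrightarrow> \<bar>i + j\<bar> = \<bar>i\<bar> + \<bar>j\<bar>"
    by linarith
  also have "\<dots> \<longleftrightarrow> 0 \<le> i * j"
    by (auto simp: zero_le_mult_iff)
  finally show ?thesis by simp
qed

lemma coord_geodesic_sgn_cong:
  assumes "coord_sgn c = coord_sgn d"
  shows "coord_conj_length c = coord_length c \<longleftrightarrow> coord_conj_length d = coord_length d"
proof -
  obtain i j e k l f where cd: "c = (i, j, e)" "d = (k, l, f)" by (cases c; cases d)
  then have "sgn (i * j) = sgn (k * l)" "e = f"
    using assms by (simp_all add: sgn_mult)
  then have "0 \<le> i * j \<longleftrightarrow> 0 \<le> k * l"
    by (auto simp: sgn_if split: if_splits)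
  then show ?thesis
    unfolding cd coord_geodesic_iff \<open>e = f\<close> by simp
qed

text \<open>For letters this is the failure of \<open>descent\<close> for the inverse
  letter.\<close>

fun ascent :: "coord \<Rightarrow> coord \<Rightarrow> bool" where
  "ascent (k, l, f) (i, j, e) = (if f then \<not> e else 0 \<le> k * i \<and> 0 \<le> l * j)"

lemma ascent_iff:
  "q \<in> letter_coords \<Longrightarrow> coord_length (cmul q c) = Suc (coord_length c) \<longleftrightarrow> ascent q c"
  by (cases c) (auto simp: letter_coords_def)

lemma ascent_sgn_cong: "coord_sgn c = coord_sgn d \<Longrightarrow> ascent q c = ascent q d"
  by (cases c; cases d; cases q) (auto simp: zero_le_mult_iff sgn_if split: if_splits)

text \<open>In general the sign of i does not determine that of i - 1. An ascending letter never
  cancels, so a nonzero entry of it fixes the new sign.\<close>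

lemma coord_sgn_ascent:
  "\<lbrakk>q \<in> letter_coords; ascent q (i, j, e)\<rbrakk> \<Longrightarrow> coord_sgn (cmul q (i, j, e)) =
    (case q of (k, l, f) \<Rightarrow> if f then (sgn j, sgn i, \<not> e)
      else (if k = 0 then sgn i else k, if l = 0 then sgn j else l, e))"
  by (auto simp: letter_coords_def)

text \<open>The transition rule on signs. As conjugacy length is at most length, the step must
  lengthen \<open>c\<close>, so it is an ascent; being an ascent and being of minimal length in the
  class depend on signs and \<open>e\<close> only.\<close>

lemma coord_sgn_step:
  assumes q: "q \<in> letter_coords" and sgn: "coord_sgn c = coord_sgn d"
    and step: "coord_conj_length (cmul q c) = Suc (coord_length c)"
  shows "coord_conj_length (cmul q d) = Suc (coord_length d)"
    and "coord_sgn (cmul q c) = coord_sgn (cmul q d)"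
proof -
  have len: "coord_length (cmul q c) = Suc (coord_length c)"
    using step coord_conj_length_le_self[of "cmul q c"] coord_length_cmul_le[OF q, of c] by simp
  then have c: "ascent q c" and d: "ascent q d"
    using ascent_iff[OF q] ascent_sgn_cong[OF sgn] by simp_all
  then show eq: "coord_sgn (cmul q c) = coord_sgn (cmul q d)"
    using sgn q by (cases c; cases d) (simp add: coord_sgn_ascent split: prod.split del: cmul.simps ascent.simps)
  have "coord_conj_length (cmul q d) = coord_length (cmul q d)"
    using coord_geodesic_sgn_cong[OF eq] step len by simp
  then show "coord_conj_length (cmul q d) = Suc (coord_length d)"
    using d ascent_iff[OF q] by simp
qed

section \<open>Words over \<open>ZZ\<close> and their coordinates\<close>

lemma ZZ_iff: "x \<in> ZZ \<longleftrightarrow> x \<in> carrier GG \<and> coord x \<in> letter_coords"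
proof
  show "x \<in> ZZ \<Longrightarrow> x \<in> carrier GG \<and> coord x \<in> letter_coords"
    by (auto simp: ZZ_def letter_coords_def coord_gen gen_elt_carrier)
next
  assume x: "x \<in> carrier GG \<and> coord x \<in> letter_coords"
  then have "\<exists>y\<in>ZZ. coord x = coord y"
    by (auto simp: ZZ_def letter_coords_def coord_gen)
  then obtain y where y: "y \<in> ZZ" "coord x = coord y" by blast
  then have "y \<in> carrier GG"
    by (auto simp: ZZ_def gen_elt_carrier)
  with x y show "x \<in> ZZ"
    by (simp add: coord_eq_iff)
qed

lemma letter_coords_ZZ: "q \<in> letter_coords \<Longrightarrow> \<exists>x\<in>ZZ. coord x = q"
  by (auto simp: letter_coords_def ZZ_def coord_gen)

lemma finite_ZZ: "finite ZZ"
  by (simp add: ZZ_def)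

lemma word_value_simps [simp]:
  "word_value G [] = \<one>\<^bsub>G\<^esub>" "word_value G (x # w) = x \<otimes>\<^bsub>G\<^esub> word_value G w"
  by (simp_all add: word_value_def)

lemma word_value_carrier: "w \<in> lists ZZ \<Longrightarrow> word_value GG w \<in> carrier GG"
  by (induction w) (auto simp: ZZ_iff)

definition word_coord :: "(gen \<times> bool) list set list \<Rightarrow> coord" where
  "word_coord w = coord (word_value GG w)"

lemma word_coord_simps [simp]:
  "word_coord [] = (0, 0, False)"
  "\<lbrakk>x \<in> ZZ; w \<in> lists ZZ\<rbrakk> \<Longrightarrow> word_coord (x # w) = cmul (coord x) (word_coord w)"
  by (simp_all add: word_coord_def coord_one coord_mult ZZ_iff word_value_carrier)

lemma word_coord_eq_iff:
  "\<lbrakk>u \<in> lists ZZ; v \<in> lists ZZ\<rbrakk> \<Longrightarrow> word_coord u = word_coord v \<longleftrightarrow> word_value GG u = word_value GG v"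
  by (simp add: word_coord_def coord_eq_iff word_value_carrier)

lemma coord_length_le_length: "w \<in> lists ZZ \<Longrightarrow> coord_length (word_coord w) \<le> length w"
proof (induction w)
  case (Cons x w)
  then show ?case
    using coord_length_cmul_le[of "coord x" "word_coord w"] by (auto simp: ZZ_iff)
qed simp

text \<open>A descent letter is split off at the front, which leaves an element of smaller
  length.\<close>

lemma geodesic_word_exists: "\<exists>w\<in>lists ZZ. word_coord w = c \<and> length w = coord_length c"
proof (induction "coord_length c" arbitrary: c rule: less_induct)
  case less
  show ?case
  proof (cases "c = (0, 0, False)")
    case True
    then show ?thesis by (intro bexI[of _ "[]"]) auto
  next
    case False
    then obtain q d where q: "q \<in> letter_coords" "cmul q d = c" "coord_length c = Suc (coord_length d)"
      using exists_descent descent_iff by metis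
    then obtain w x where "w \<in> lists ZZ" "word_coord w = d" "length w = coord_length d"
      "x \<in> ZZ" "coord x = q"
      using less[of d] letter_coords_ZZ[of q] by auto
    then show ?thesis
      using q by (intro bexI[of _ "x # w"]) auto
  qed
qed

lemma coord_surj: "\<exists>g\<in>carrier GG. coord g = c"
  using geodesic_word_exists[of c] word_value_carrier by (auto simp: word_coord_def)

text \<open>\<open>coord\<close> is an isomorphism onto the triples under \<open>cmul\<close>;
  \<open>h\<close> merely renders the Boolean as 0 or 1.\<close>

lemma GG_iso:
  "GG \<cong> semidirect_product (integer_group \<times>\<times> integer_group) (integer_mod_group 2) swap_action"
    (is "_ \<cong> ?S")
proof -
  define h :: "coord \<Rightarrow> (int \<times> int) \<times> int" where "h = (\<lambda>(i, j, e). ((i, j), of_bool e))"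
  have h_carrier: "h c \<in> carrier ?S" for c
    by (cases c) (auto simp: h_def semidirect_product_def carrier_integer_mod_group)
  have "(\<lambda>g. h (coord g)) \<in> hom GG ?S"
  proof (rule homI)
    fix g k assume g: "g \<in> carrier GG" "k \<in> carrier GG"
    show "h (coord g) \<in> carrier ?S"
      by (rule h_carrier)
    show "h (coord (g \<otimes>\<^bsub>GG\<^esub> k)) = h (coord g) \<otimes>\<^bsub>?S\<^esub> h (coord k)"
      unfolding coord_mult[OF g]
      by (cases "coord g"; cases "coord k")
        (auto simp: h_def semidirect_product_def swap_action_def DirProd_def)
  qed
  moreover have "bij_betw (\<lambda>g. h (coord g)) (carrier GG) (carrier ?S)"
    unfolding bij_betw_def
  proof
    have "inj h"
      by (auto simp: inj_def h_def)
    then show "inj_on (\<lambda>g. h (coord g)) (carrier GG)"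
      by (intro inj_onI) (metis coord_eq_iff injD)
    have "x \<in> (\<lambda>g. h (coord g)) ` carrier GG" if "x \<in> carrier ?S" for x
    proof -
      have "x = h (fst (fst x), snd (fst x), snd x = 1)"
        using that by (auto simp: h_def semidirect_product_def carrier_integer_mod_group)
      moreover obtain g where "g \<in> carrier GG" "coord g = (fst (fst x), snd (fst x), snd x = 1)"
        using coord_surj by blast
      ultimately show ?thesis by (auto intro!: image_eqI)
    qed
    with h_carrier show "(\<lambda>g. h (coord g)) ` carrier GG = carrier ?S"
      by blast
  qed
  ultimately show ?thesis
    by (auto simp: is_iso_def iso_def)
qed

section \<open>Length and conjugacy in \<open>GG\<close> in terms of coordinates\<close>

lemma element_length_GG:
  assumes "g \<in> carrier GG"
  shows "element_length GG ZZ g = coord_length (coord g)"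
  unfolding element_length_def
proof (rule Least_equality)
  obtain w where w: "w \<in> lists ZZ" "word_coord w = coord g" "length w = coord_length (coord g)"
    using geodesic_word_exists by blast
  then have "word_value GG w = g"
    using assms by (simp add: word_coord_def coord_eq_iff word_value_carrier)
  with w show "\<exists>w\<in>lists ZZ. word_value GG w = g \<and> length w = coord_length (coord g)" by blast
qed (use coord_length_le_length in \<open>auto simp: word_coord_def\<close>)

lemma conjugacy_class_GG:
  assumes g: "g \<in> carrier GG"
  shows "conjugacy_class GG g = {h \<in> carrier GG. coord_conj (coord g) (coord h)}"
proof -
  have "(\<exists>x\<in>carrier GG. h = inv\<^bsub>GG\<^esub> x \<otimes>\<^bsub>GG\<^esub> g \<otimes>\<^bsub>GG\<^esub> x) \<longleftrightarrow> coord_conj (coord g) (coord h)"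
    if h: "h \<in> carrier GG" for h
  proof -
    have "h = inv\<^bsub>GG\<^esub> x \<otimes>\<^bsub>GG\<^esub> g \<otimes>\<^bsub>GG\<^esub> x \<longleftrightarrow> cmul (coord x) (coord h) = cmul (coord g) (coord x)"
      if x: "x \<in> carrier GG" for x
    proof -
      have "h = inv\<^bsub>GG\<^esub> x \<otimes>\<^bsub>GG\<^esub> g \<otimes>\<^bsub>GG\<^esub> x \<longleftrightarrow> x \<otimes>\<^bsub>GG\<^esub> h = g \<otimes>\<^bsub>GG\<^esub> x"
        using g h x by (auto simp: GG.m_assoc GG.inv_solve_left)
      then show ?thesis
        using g h x by (simp add: coord_eq_iff flip: coord_mult)
    qed
    moreover have "(\<exists>x\<in>carrier GG. P (coord x)) \<longleftrightarrow> (\<exists>c. P c)" for P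
      using coord_surj by metis
    ultimately show ?thesis
      by (simp add: coord_conj_iff cong: bex_cong)
  qed
  moreover have "conjugacy_class GG g \<subseteq> carrier GG"
    using g by (auto simp: conjugacy_class_def)
  ultimately show ?thesis
    unfolding conjugacy_class_def by blast
qed

lemma conj_length_GG:
  assumes g: "g \<in> carrier GG"
  shows "conj_length GG ZZ g = coord_conj_length (coord g)"
  unfolding conj_length_def conjugacy_class_GG[OF g]
proof (rule Least_equality)
  obtain h where "h \<in> carrier GG" "coord_conj (coord g) (coord h)"
    "coord_length (coord h) = coord_conj_length (coord g)"
    using coord_surj coord_conj_length_attained by metis
  then show "\<exists>h\<in>{h \<in> carrier GG. coord_conj (coord g) (coord h)}.
      element_length GG ZZ h = coord_conj_length (coord g)"
    by (auto simp: element_length_GG)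
qed (auto simp: element_length_GG coord_conj_length_le)

lemma ConjGeo_GG: "ConjGeo GG ZZ = {w \<in> lists ZZ. coord_conj_length (word_coord w) = length w}"
  using word_value_carrier by (force simp: ConjGeo_def conj_length_GG word_coord_def)

section \<open>The languages of geodesics\<close>

text \<open>Among the geodesic words exactly the shortlex least ones are greedy.\<close>

fun greedy :: "((gen \<times> bool) list set \<times> (gen \<times> bool) list set) set
    \<Rightarrow> (gen \<times> bool) list set list \<Rightarrow> bool" where
  "greedy r [] = True"
| "greedy r (p # s) \<longleftrightarrow>
     greedy r s \<and> (\<forall>q\<in>ZZ. descent (coord q) (word_coord (p # s)) \<longrightarrow> (p, q) \<in> r)"

text \<open>Through this case the regularity proof for greedy words covers \<open>ConjGeo\<close>
  itself.\<close>

lemma greedy_UNIV: "greedy UNIV w"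
  by (induction w) auto

text \<open>Each letter raises the length by at most one, so in a geodesic word it raises it by
  exactly one.\<close>

lemma geodesic_ConsD:
  assumes "x \<in> ZZ" "w \<in> lists ZZ" "coord_length (word_coord (x # w)) = length (x # w)"
  shows "coord_length (word_coord w) = length w" "descent (coord x) (word_coord (x # w))"
proof -
  have x: "coord x \<in> letter_coords"
    using assms by (simp add: ZZ_iff)
  show *: "coord_length (word_coord w) = length w"
    using assms coord_length_cmul_le[OF x, of "word_coord w"] coord_length_le_length[of w] by simp
  show "descent (coord x) (word_coord (x # w))"
    unfolding descent_iff[OF x] using assms * by (intro exI[of _ "word_coord w"]) simp
qed

text \<open>Both first letters are descents of the same element, so each is related to the other;
  antisymmetry identifies them, and cancelling them leaves a shorter instance.\<close>

lemma greedy_geodesic_unique: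
  assumes "antisym r" "u \<in> lists ZZ" "v \<in> lists ZZ" "greedy r u" "greedy r v"
    "coord_length (word_coord u) = length u" "coord_length (word_coord v) = length v"
    "word_coord u = word_coord v"
  shows "u = v"
  using assms(2-)
proof (induction u arbitrary: v rule: list.induct)
  case (Cons p s)
  then obtain q s' where v: "v = q # s'"
    by (cases v) auto
  from Cons.prems(1,2) have s: "p \<in> ZZ" "s \<in> lists ZZ" "q \<in> ZZ" "s' \<in> lists ZZ"
    by (auto simp: v)
  then have geo: "coord_length (word_coord s) = length s" "coord_length (word_coord s') = length s'"
    and "descent (coord p) (word_coord (p # s))" "descent (coord q) (word_coord (q # s'))"
    using Cons.prems geodesic_ConsD unfolding v by blast+
  then have "(p, q) \<in> r" "(q, p) \<in> r"
    using Cons.prems s unfolding v greedy.simps by metis+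
  with \<open>antisym r\<close> have "p = q" by (rule antisymD)
  moreover have "word_value GG (p # s) = word_value GG (q # s')"
    using Cons.prems word_coord_eq_iff unfolding v by blast
  ultimately have "word_coord s = word_coord s'"
    using s by (auto simp: word_coord_eq_iff ZZ_iff word_value_carrier)
  moreover have "greedy r s" "greedy r s'"
    using Cons.prems by (auto simp: v)
  ultimately have "s = s'"
    using s geo by (intro Cons.IH)
  with \<open>p = q\<close> show ?case
    by (simp add: v)
next
  case Nil
  then have "length v = coord_length (0, 0, False)"
    by (metis word_coord_simps(1))
  then show ?case by simp
qed

text \<open>A descent \<open>q\<close> begins some geodesic word for the same element, and
  comparison with that word at the first letter yields \<open>(p, q) \<in> r\<close>. The suffix is
  again least, since its rivals can be prefixed by \<open>p\<close>.\<close>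

lemma least_imp_greedy:
  assumes r: "total_on ZZ r" and "refl_on ZZ r" and "w \<in> lists ZZ" "coord_length (word_coord w) = length w"
    "\<And>v. \<lbrakk>v \<in> lists ZZ; word_coord v = word_coord w; v \<noteq> w\<rbrakk> \<Longrightarrow> (w, v) \<in> lenlex (r - Id)"
  shows "greedy r w"
  using assms(3-)
proof (induction w)
  case (Cons p s)
  then have s: "p \<in> ZZ" "s \<in> lists ZZ" by auto
  then have geo: "coord_length (word_coord s) = length s"
    using geodesic_ConsD Cons.prems by blast
  have "greedy r s"
  proof (rule Cons.IH)
    fix v assume v: "v \<in> lists ZZ" "word_coord v = word_coord s" "v \<noteq> s"
    then have "(p # s, p # v) \<in> lenlex (r - Id)"
      using s by (intro Cons.prems) auto
    then show "(s, v) \<in> lenlex (r - Id)"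
      by (auto simp: Cons_lenlex_iff lenlex_conv)
  qed (use s geo in auto)
  moreover have "(p, q) \<in> r" if q: "q \<in> ZZ" "descent (coord q) (word_coord (p # s))" for q
  proof (cases "q = p")
    case True
    then show ?thesis using q \<open>refl_on ZZ r\<close> by (auto simp: refl_on_def)
  next
    case False
    have "coord q \<in> letter_coords" using q by (simp add: ZZ_iff)
    then obtain d where d: "cmul (coord q) d = word_coord (p # s)"
      "coord_length (word_coord (p # s)) = Suc (coord_length d)"
      using q descent_iff by blast
    obtain v where v: "v \<in> lists ZZ" "word_coord v = d" "length v = coord_length d"
      using geodesic_word_exists by blast
    then have "(p # s, q # v) \<in> lenlex (r - Id)"
      using d q False by (intro Cons.prems) auto
    moreover have "length v = length s"
      using v d Cons.prems by simp
    ultimately show ?thesis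
      using False by (simp add: Cons_lenlex_iff)
  qed
  ultimately show ?case by simp
qed simp

text \<open>A word outside this language has no extension to the left inside it; for a word inside,
  the signs and \<open>e\<close> decide which extensions stay inside. The relation \<open>r\<close>
  will be an order for \<open>ConjMinLenSL\<close> and \<open>UNIV\<close> for
  \<open>ConjGeo\<close>.\<close>

lemma regular_greedy_ConjGeo: "regular_language ZZ {w \<in> ConjGeo GG ZZ. greedy r w}"
proof -
  define L where "L = {w \<in> ConjGeo GG ZZ. greedy r w}"
  define f where "f w = (if w \<in> L then Some (coord_sgn (word_coord w)) else None)" for w
  have L_iff: "w \<in> L \<longleftrightarrow> w \<in> lists ZZ \<and> coord_conj_length (word_coord w) = length w \<and> greedy r w" for w
    by (auto simp: L_def ConjGeo_GG)
  have Cons_L: "x # v \<in> L \<and> f (x # u) = f (x # v)"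
    if x: "x \<in> ZZ" and v: "v \<in> lists ZZ" and f: "f u = f v" and xu: "x # u \<in> L" for x u v
  proof -
    have q: "coord x \<in> letter_coords" using x by (simp add: ZZ_iff)
    have u: "u \<in> lists ZZ" using xu by (simp add: L_iff)
    have step: "coord_conj_length (cmul (coord x) (word_coord u)) = Suc (length u)"
      using xu x u by (simp add: L_iff)
    from coord_conj_length_step[OF q coord_length_le_length[OF u] this]
    have ulen: "coord_conj_length (word_coord u) = length u" "coord_length (word_coord u) = length u" .
    then have "u \<in> L"
      using u xu by (simp add: L_iff)
    with f have "v \<in> L" and sgn: "coord_sgn (word_coord u) = coord_sgn (word_coord v)"
      by (auto simp: f_def split: if_splits)
    then have vlen: "coord_conj_length (word_coord v) = length v" and "greedy r v"
      by (auto simp: L_iff)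
    then have "coord_length (word_coord v) = length v"
      using coord_geodesic_sgn_cong[OF sgn] ulen by simp
    with coord_sgn_step[OF q sgn] step ulen
    have xv: "coord_conj_length (word_coord (x # v)) = length (x # v)"
      and xsgn: "coord_sgn (word_coord (x # u)) = coord_sgn (word_coord (x # v))"
      using x u v by auto
    have "greedy r (x # v)"
      using xu \<open>greedy r v\<close> descent_sgn_cong[OF xsgn] unfolding L_iff greedy.simps by blast
    with xv x v have "x # v \<in> L"
      unfolding L_iff by simp
    with xu xsgn show ?thesis
      unfolding f_def by simp
  qed
  show ?thesis
    unfolding L_def[symmetric]
  proof (rule regular_language_left_congruence[of f])
    \<comment> \<open>Three values for each sign, two for \<open>e\<close>, and \<open>None\<close>
      bound the image of \<open>f\<close>.\<close>
    have sgn: "coord_sgn c \<in> {-1, 0, 1} \<times> {-1, 0, 1} \<times> UNIV" for c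
      by (cases c) (auto simp: sgn_if)
    have "f w \<in> insert None (Some ` ({-1, 0, 1} \<times> {-1, 0, 1} \<times> UNIV))" for w
      using sgn[of "word_coord w"] by (simp only: f_def split: if_split) blast
    then have "f ` lists ZZ \<subseteq> insert None (Some ` ({-1, 0, 1} \<times> {-1, 0, 1} \<times> UNIV))"
      by (rule image_subsetI)
    then show "finite (f ` lists ZZ)"
      by (rule finite_subset) auto
    show "f (x # u) = f (x # v)"
      if "x \<in> ZZ" "u \<in> lists ZZ" "v \<in> lists ZZ" "f u = f v" for x u v
    proof (cases "x # u \<in> L \<or> x # v \<in> L")
      case True
      then show ?thesis using Cons_L[of x] that by metis
    next
      case False
      then show ?thesis unfolding f_def by simp
    qed
    show "L \<subseteq> lists ZZ"
      using L_iff by blast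
    show "v \<in> L" if "u \<in> L" "f u = f v" for u v
      using that unfolding f_def by (metis option.distinct(1))
  qed
qed

context
  fixes r
  assumes r: "linear_order_on ZZ r"
begin

lemma order_props: "total_on ZZ r" "refl_on ZZ r" "antisym r"
  using r by (auto simp: order_on_defs)

lemma shortlex_element_GG:
  assumes g: "g \<in> carrier GG"
  shows "shortlex_element GG ZZ r g \<in> lists ZZ"
    and "word_value GG (shortlex_element GG ZZ r g) = g"
    and "length (shortlex_element GG ZZ r g) = coord_length (coord g)"
    and "greedy r (shortlex_element GG ZZ r g)"
proof -
  let ?W = "{w \<in> lists ZZ. word_value GG w = g}" and ?y = "shortlex_element GG ZZ r g"
  obtain w where w: "w \<in> lists ZZ" "word_coord w = coord g" "length w = coord_length (coord g)"
    using geodesic_word_exists by blast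
  then have wW: "w \<in> ?W"
    using g by (simp add: word_coord_def coord_eq_iff word_value_carrier)
  then have W: "?W \<subseteq> lists ZZ" "?W \<noteq> {}" by auto
  have y: "?y \<in> ?W" "\<And>v. v \<in> ?W \<Longrightarrow> v \<noteq> ?y \<Longrightarrow> (?y, v) \<in> lenlex (r - Id)"
    unfolding shortlex_element_def
    using shortlex_least_in[OF r finite_ZZ W] shortlex_least_less[OF r finite_ZZ W] by auto
  then show "?y \<in> lists ZZ" "word_value GG ?y = g" by auto
  have "length ?y \<le> length w"
    using y(2)[OF wW] by (cases "w = ?y") (auto dest: lenlex_length)
  moreover have "word_coord ?y = coord g"
    using y by (simp add: word_coord_def)
  ultimately show len: "length ?y = coord_length (coord g)"
    using y w coord_length_le_length[of ?y] by simp
  show "greedy r ?y"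
    using order_props(1,2)
  proof (rule least_imp_greedy)
    show "(?y, v) \<in> lenlex (r - Id)" if "v \<in> lists ZZ" "word_coord v = word_coord ?y" "v \<noteq> ?y" for v
      using that y by (simp add: word_coord_eq_iff)
  qed (use y len \<open>word_coord ?y = coord g\<close> in auto)
qed

text \<open>The shortlex word is itself geodesic and greedy, so uniqueness identifies it with
  \<open>w\<close>.\<close>

lemma shortlex_element_eqI:
  assumes w: "w \<in> lists ZZ" "coord_length (word_coord w) = length w" "greedy r w"
  shows "shortlex_element GG ZZ r (word_value GG w) = w"
proof -
  note y = shortlex_element_GG[OF word_value_carrier[OF w(1)]]
  then show ?thesis
    using greedy_geodesic_unique[OF order_props(3) y(1) w(1) y(4) w(3)] w
    by (simp add: word_coord_def)
qed

lemma ConjMinLenSL_GG: "ConjMinLenSL GG ZZ r = {w \<in> ConjGeo GG ZZ. greedy r w}"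
proof (intro subset_antisym subsetI)
  fix w assume "w \<in> ConjMinLenSL GG ZZ r"
  then obtain g where g: "g \<in> carrier GG" "coord_length (coord g) = coord_conj_length (coord g)"
    and w: "w = shortlex_element GG ZZ r g"
    by (auto simp: ConjMinLenSL_def element_length_GG conj_length_GG)
  then show "w \<in> {w \<in> ConjGeo GG ZZ. greedy r w}"
    using shortlex_element_GG[OF g(1)] by (simp add: ConjGeo_GG word_coord_def)
next
  fix w assume "w \<in> {w \<in> ConjGeo GG ZZ. greedy r w}"
  then have w: "w \<in> lists ZZ" "greedy r w" "coord_conj_length (word_coord w) = length w"
    by (auto simp: ConjGeo_GG)
  then have "coord_length (word_coord w) = length w"
    using coord_length_le_length coord_conj_length_le_self by (metis le_antisym)
  with w show "w \<in> ConjMinLenSL GG ZZ r"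
    using shortlex_element_eqI[of w] word_value_carrier[of w]
    unfolding ConjMinLenSL_def
    by (auto simp: element_length_GG conj_length_GG word_coord_def intro!: exI[of _ "word_value GG w"])
qed

end

section \<open>Shortlex least words of conjugacy classes\<close>

text \<open>Each conjugacy class of length \<open>n\<close> contains exactly one element with coordinates in this set.\<close>

definition class_reps :: "nat \<Rightarrow> coord set" where
  "class_reps n = {(i, j, False) | i j. i \<le> j \<and> nat \<bar>i\<bar> + nat \<bar>j\<bar> = n} \<union>
     {(0, s, True) | s. Suc (nat \<bar>s\<bar>) = n}"

context
  fixes r
  assumes r: "linear_order_on ZZ r"
begin

lemma shortlex_class_GG:
  assumes g: "g \<in> carrier GG"
  defines "y \<equiv> shortlex_class GG ZZ r (conjugacy_class GG g)"
  shows "y \<in> lists ZZ" and "word_value GG y \<in> conjugacy_class GG g"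
    and "length y = coord_conj_length (coord g)"
    and "\<And>v. \<lbrakk>v \<in> lists ZZ; coord_conj (coord g) (word_coord v); v \<noteq> y\<rbrakk> \<Longrightarrow> (y, v) \<in> lenlex (r - Id)"
proof -
  let ?W = "{w \<in> lists ZZ. word_value GG w \<in> conjugacy_class GG g}"
  obtain d where d: "coord_conj (coord g) d" "coord_length d = coord_conj_length (coord g)"
    using coord_conj_length_attained by blast
  obtain w where w: "w \<in> lists ZZ" "word_coord w = d" "length w = coord_length d"
    using geodesic_word_exists by blast
  have W_iff: "v \<in> ?W \<longleftrightarrow> v \<in> lists ZZ \<and> coord_conj (coord g) (word_coord v)" for v
    using word_value_carrier[of v] by (auto simp: conjugacy_class_GG[OF g] word_coord_def)
  have wW: "w \<in> ?W"
    unfolding W_iff using w d by simp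
  then have W: "?W \<subseteq> lists ZZ" "?W \<noteq> {}" by auto
  have y: "y \<in> ?W" "\<And>v. v \<in> ?W \<Longrightarrow> v \<noteq> y \<Longrightarrow> (y, v) \<in> lenlex (r - Id)"
    unfolding y_def shortlex_class_def
    using shortlex_least_in[OF r finite_ZZ W] shortlex_least_less[OF r finite_ZZ W] by auto
  then show "y \<in> lists ZZ" "word_value GG y \<in> conjugacy_class GG g" by auto
  have "length y \<le> length w"
    using y(2)[OF wW] by (cases "w = y") (auto dest: lenlex_length)
  moreover have "coord_conj_length (coord g) \<le> length y"
    using y(1) coord_conj_length_le coord_length_le_length unfolding W_iff by (meson le_trans)
  ultimately show "length y = coord_conj_length (coord g)"
    using w d by simp
  show "(y, v) \<in> lenlex (r - Id)"
    if "v \<in> lists ZZ" "coord_conj (coord g) (word_coord v)" "v \<noteq> y" for v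
    using y(2) that unfolding W_iff by blast
qed

text \<open>Turns membership into a test on the word itself, free of the class that it was chosen
  from.\<close>

lemma ConjSL_GG_iff:
  "w \<in> ConjSL GG ZZ r \<longleftrightarrow> w \<in> lists ZZ \<and>
    (\<forall>v\<in>lists ZZ. coord_conj (word_coord w) (word_coord v) \<longrightarrow> v \<noteq> w \<longrightarrow> (w, v) \<in> lenlex (r - Id))"
  (is "_ \<longleftrightarrow> ?R")
proof
  assume "w \<in> ConjSL GG ZZ r"
  then obtain g where g: "g \<in> carrier GG" and w: "w = shortlex_class GG ZZ r (conjugacy_class GG g)"
    by (auto simp: ConjSL_def)
  have "coord_conj (coord g) (word_coord w)"
    using shortlex_class_GG(1,2)[OF g] word_value_carrier
    by (auto simp: conjugacy_class_GG[OF g] w word_coord_def)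
  \<comment> \<open>Transitivity of conjugacy: the rivals of \<open>w\<close> on the right side lie
    in the class of \<open>g\<close>.\<close>
  then have "coord_conj (coord g) d" if "coord_conj (word_coord w) d" for d
    using that by (cases "coord g"; cases d; cases "word_coord w") (auto split: if_splits)
  then show ?R
    using shortlex_class_GG[OF g] unfolding w by blast
next
  assume R: ?R
  then have g: "word_value GG w \<in> carrier GG"
    by (simp add: word_value_carrier)
  let ?y = "shortlex_class GG ZZ r (conjugacy_class GG (word_value GG w))"
  have "?y \<in> lists ZZ" "coord_conj (word_coord w) (word_coord ?y)"
    using shortlex_class_GG(1,2)[OF g] by (auto simp: conjugacy_class_GG[OF g] word_coord_def)
  moreover have "(?y, w) \<in> lenlex (r - Id)" if "w \<noteq> ?y"
    using shortlex_class_GG(4)[OF g, of w] that R coord_conj_refl by (simp add: word_coord_def)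
  \<comment> \<open>If \<open>w\<close> and \<open>?y\<close> differed, each would precede the
    other.\<close>
  moreover have "asym (r - Id)"
    using order_props(3)[OF r] by (auto intro!: asymI dest: antisymD)
  then have "asym (lenlex (r - Id))"
    by (rule asym_lenlex)
  ultimately have "w = ?y"
    using R by (metis asymD)
  then show "w \<in> ConjSL GG ZZ r"
    using g unfolding ConjSL_def by blast
qed

section \<open>Non-regularity of \<open>ConjSL\<close>\<close>

lemma word_coord_replicate:
  assumes "x \<in> ZZ" "w \<in> lists ZZ" "coord x = (k, l, False)" "word_coord w = (i, j, e)"
  shows "word_coord (replicate n x @ w) = (int n * k + i, int n * l + j, e)"
proof -
  have "replicate n x @ w \<in> lists ZZ" for n
    using assms by (auto simp: in_lists_conv_set)
  then show ?thesis
    using assms by (induction n) (simp_all add: algebra_simps)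
qed

lemma ConjSL_not_regular: "\<not> regular_language ZZ (ConjSL GG ZZ r)"
proof
  assume reg: "regular_language ZZ (ConjSL GG ZZ r)"
  have ne: "gen_elt Gen_a \<noteq> gen_elt Gen_b"
    using coord_gen by (metis prod.inject zero_neq_one)
  have "gen_elt Gen_a \<in> ZZ" "gen_elt Gen_b \<in> ZZ"
    by (auto simp: ZZ_def)
  with ne have "(gen_elt Gen_a, gen_elt Gen_b) \<in> r \<or> (gen_elt Gen_b, gen_elt Gen_a) \<in> r"
    using order_props(1)[OF r] unfolding total_on_def by blast
  \<comment> \<open>The number \<open>k\<close> treats both orders at once: it is 1 when
    \<open>x\<close> is a and 0 when \<open>x\<close> is b.\<close>
  then obtain x y k where xy: "(x, y) \<in> r" "x \<in> ZZ" "y \<in> ZZ" "x \<noteq> y"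
    and coord: "coord x = (k, 1 - k, False)" "coord y = (1 - k, k, False)" and k: "k = 0 \<or> k = 1"
  proof
    assume "(gen_elt Gen_a, gen_elt Gen_b) \<in> r"
    then show ?thesis
      by (intro that[of "gen_elt Gen_a" "gen_elt Gen_b" 1]) (auto simp: ne coord_gen ZZ_def)
  next
    assume "(gen_elt Gen_b, gen_elt Gen_a) \<in> r"
    then show ?thesis
      by (intro that[of "gen_elt Gen_b" "gen_elt Gen_a" 0]) (auto simp: ne[symmetric] coord_gen ZZ_def)
  qed
  have lists: "replicate m y \<in> lists ZZ" "replicate n x @ replicate m y \<in> lists ZZ" for m n
    using xy by (auto simp: in_lists_conv_set)
  have val_y: "word_coord (replicate m y) = (int m * (1 - k), int m * k, False)" for m
    using word_coord_replicate[OF xy(3) _ coord(2), of "[]" 0 0 False m] by simp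
  have val: "word_coord (replicate n x @ replicate m y) =
      (int n * k + int m * (1 - k), int n * (1 - k) + int m * k, False)" for n m
    by (rule word_coord_replicate[OF xy(2) lists(1) coord(1) val_y])
  \<comment> \<open>The exponents are nonnegative and t is absent, so only \<open>x\<close> and
    \<open>y\<close> can be descents, and only \<open>y\<close> if no \<open>x\<close>
    occurs.\<close>
  have greedy: "greedy r (replicate n x @ replicate m y)" for n m
  proof (induction n)
    case 0
    show ?case
    proof (induction m)
      case (Suc m)
      have "(y, q) \<in> r" if "q \<in> ZZ" "descent (coord q) (word_coord (replicate (Suc m) y))" for q
      proof -
        have "coord q = coord y"
          using that k unfolding val_y ZZ_iff letter_coords_def coord by auto
        then have "q = y"
          using that xy by (simp add: ZZ_iff coord_eq_iff)
        then show ?thesis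
          using order_props(2)[OF r] xy by (auto simp: refl_on_def)
      qed
      with Suc show ?case by simp
    qed simp
  next
    case (Suc n)
    have "(x, q) \<in> r" if "q \<in> ZZ" "descent (coord q) (word_coord (replicate (Suc n) x @ replicate m y))" for q
    proof -
      have "coord q = coord x \<or> coord q = coord y"
        using that k unfolding val ZZ_iff letter_coords_def coord by auto
      then have "q = x \<or> q = y"
        using that xy by (simp add: ZZ_iff coord_eq_iff)
      then show ?thesis
        using order_props(2)[OF r] xy by (auto simp: refl_on_def)
    qed
    with Suc show ?case by simp
  qed
  \<comment> \<open>With equal exponents the element is alone in its conjugacy class, so its
    shortlex word is that of the class.\<close>
  have "replicate n x @ replicate n y \<in> ConjSL GG ZZ r" for n
  proof -
    let ?w = "replicate n x @ replicate n y"
    have w: "word_coord ?w = (int n, int n, False)"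
      unfolding val by (simp add: algebra_simps)
    have eq: "shortlex_element GG ZZ r (word_value GG ?w) = ?w"
      by (rule shortlex_element_eqI[OF r lists(2) _ greedy]) (simp add: w)
    have "(?w, v) \<in> lenlex (r - Id)"
      if "v \<in> lists ZZ" "coord_conj (word_coord ?w) (word_coord v)" "v \<noteq> ?w" for v
    proof -
      have "word_coord v = word_coord ?w"
        using that(2) unfolding w by (cases "word_coord v") auto
      then have "v \<in> {v \<in> lists ZZ. word_value GG v = word_value GG ?w}"
        using that(1) lists by (simp add: word_coord_eq_iff)
      with that(3) show ?thesis
        using shortlex_least_less[OF r finite_ZZ, of "{v \<in> lists ZZ. word_value GG v = word_value GG ?w}" v]
          eq unfolding shortlex_element_def by auto
    qed
    then show ?thesis
      unfolding ConjSL_GG_iff using lists by blast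
  qed
  from regular_language_pumping[OF reg xy(2,3) this]
  obtain i j where ij: "i < j" and w: "replicate i x @ replicate j y \<in> ConjSL GG ZZ r"
    by blast
  \<comment> \<open>The second word is the conjugate with exchanged exponents. After
    \<open>i\<close> common letters it has \<open>x\<close> where the first has
    \<open>y\<close>.\<close>
  let ?w = "replicate i x @ replicate j y" and ?v = "replicate j x @ replicate i y"
  have "replicate j x = replicate i x @ x # replicate (j - i - 1) x"
    using ij replicate_add[of i "Suc (j - i - 1)" x] by simp
  then have v: "?v = replicate i x @ x # replicate (j - i - 1) x @ replicate i y"
    by simp
  have w': "?w = replicate i x @ y # replicate (j - 1) y"
    using ij by (cases j) auto
  have "?v \<noteq> ?w"
    unfolding v w' using xy by simp
  moreover have "coord_conj (word_coord ?w) (word_coord ?v)"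
    unfolding val using k by auto
  ultimately have "(?w, ?v) \<in> lenlex (r - Id)"
    using w lists unfolding ConjSL_GG_iff by blast
  then have "(y, x) \<in> r"
    unfolding v w' using xy ij by (auto simp: irrefl_def Cons_lenlex_iff)
  with xy order_props(3)[OF r] show False
    by (auto dest: antisymD)
qed

section \<open>Counting conjugacy classes and the growth series\<close>

lemma card_ConjSL: "card {w \<in> ConjSL GG ZZ r. length w = n} = card (class_reps n)"
proof -
  define elt where "elt c = (SOME g. g \<in> carrier GG \<and> coord g = c)" for c
  have elt: "elt c \<in> carrier GG" "coord (elt c) = c" for c
    using someI_ex[of "\<lambda>g. g \<in> carrier GG \<and> coord g = c"] coord_surj[of c]
    by (auto simp: elt_def)
  define z where "z c = shortlex_class GG ZZ r (conjugacy_class GG (elt c))" for c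
  have z: "coord_conj c (word_coord (z c))" "length (z c) = coord_conj_length c" for c
    using shortlex_class_GG[OF elt(1)[of c]]
    by (auto simp: z_def conjugacy_class_GG elt word_coord_def)
  \<comment> \<open>Equal words have equal coordinates, and no two representatives are conjugate to
    the same element.\<close>
  have "inj_on z (class_reps n)"
  proof (rule inj_onI)
    fix c d assume "c \<in> class_reps n" "d \<in> class_reps n" "z c = z d"
    then show "c = d"
      using z(1)[of c] z(1)[of d]
      by (cases "word_coord (z d)") (auto simp: class_reps_def)
  qed
  moreover have "z ` class_reps n = {w \<in> ConjSL GG ZZ r. length w = n}"
  proof (intro subset_antisym subsetI)
    fix w assume "w \<in> z ` class_reps n"
    then obtain c where "c \<in> class_reps n" "w = z c" by blast
    then show "w \<in> {w \<in> ConjSL GG ZZ r. length w = n}"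
      using z(2)[of c] elt(1)[of c] by (auto simp: ConjSL_def class_reps_def z_def)
  next
    fix w assume "w \<in> {w \<in> ConjSL GG ZZ r. length w = n}"
    then obtain g where g: "g \<in> carrier GG" and w: "w = shortlex_class GG ZZ r (conjugacy_class GG g)"
      and n: "coord_conj_length (coord g) = n"
      using shortlex_class_GG(3) by (auto simp: ConjSL_def)
    obtain i j e where ije: "coord g = (i, j, e)" by (cases "coord g")
    \<comment> \<open>Normalisation into \<open>class_reps\<close>: the exponents are sorted or, if
      t occurs, their sum is put into the second one.\<close>
    define c where "c = (if e then (0, i + j, True) else (min i j, max i j, False))"
    have "coord_conj c d \<longleftrightarrow> coord_conj (i, j, e) d" for d
      by (cases d) (auto simp: c_def min_def max_def)
    then have "conjugacy_class GG (elt c) = conjugacy_class GG g"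
      using g by (simp add: conjugacy_class_GG elt ije)
    then have "w = z c" by (simp add: w z_def)
    moreover have "c \<in> class_reps n"
      using n by (auto simp: c_def class_reps_def ije min_def max_def)
    ultimately show "w \<in> z ` class_reps n" by blast
  qed
  ultimately show ?thesis
    by (metis card_image)
qed

end

text \<open>Among the pairs i \<le> j, the sign patterns 0 \<le> i, i < 0 \<le> j and j < 0
  contribute \<open>n div 2 + 1\<close>, \<open>n\<close> and \<open>n div 2\<close>. The last
  summand counts the s with |s| = n - 1.\<close>

lemma card_class_reps:
  "card (class_reps n) = 2 * (n div 2) + n + 1 + (if n = 0 then 0 else if n = 1 then 1 else 2)"
proof -
  define A where "A = (\<lambda>i. (i, int n - i, False)) ` {0..int n div 2}"
  define B where "B = (\<lambda>i. (i, int n + i, False)) ` {- int n..<0}"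
  define C where "C = (\<lambda>j. (- int n - j, j, False)) ` {- (int n div 2)..<0}"
  define D where "D = (\<lambda>s :: int. (0 :: int, s, True)) ` {s. Suc (nat \<bar>s\<bar>) = n}"
  have "class_reps n = A \<union> B \<union> C \<union> D"
  proof (intro subset_antisym subsetI)
    fix c assume c: "c \<in> class_reps n"
    obtain i j e where ije: "c = (i, j, e)" by (cases c)
    consider "e" | "\<not> e" "0 \<le> i" | "\<not> e" "i < 0" "0 \<le> j" | "\<not> e" "i < 0" "j < 0"
      by linarith
    then show "c \<in> A \<union> B \<union> C \<union> D"
    proof cases
      case 1
      then have "c \<in> D" using c by (auto simp: ije D_def class_reps_def image_iff)
      then show ?thesis by blast
    next
      case 2
      then have "c \<in> A" using c by (auto simp: ije A_def class_reps_def image_iff)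
      then show ?thesis by blast
    next
      case 3
      then have "c \<in> B" using c by (auto simp: ije B_def class_reps_def image_iff)
      then show ?thesis by blast
    next
      case 4
      then have "c \<in> C" using c by (auto simp: ije C_def class_reps_def image_iff)
      then show ?thesis by blast
    qed
  next
    fix c assume "c \<in> A \<union> B \<union> C \<union> D"
    then show "c \<in> class_reps n"
      unfolding A_def B_def C_def D_def class_reps_def by auto
  qed
  moreover have "card A = Suc (n div 2)" "card B = n" "card C = n div 2"
    unfolding A_def B_def C_def by (simp_all add: card_image inj_on_def nat_div_distrib)
  moreover have "card D = (if n = 0 then 0 else if n = 1 then 1 else 2)"
  proof -
    have "{s. Suc (nat \<bar>s\<bar>) = n} = (if n = 0 then {} else {int n - 1, 1 - int n})"
      by auto
    then show ?thesis
      unfolding D_def by (simp add: card_image inj_on_def)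
  qed
  moreover have "A \<inter> B = {}" "(A \<union> B) \<inter> C = {}" "(A \<union> B \<union> C) \<inter> D = {}"
    unfolding A_def B_def C_def D_def by auto
  moreover have "finite A" "finite B" "finite C"
    unfolding A_def B_def C_def by auto
  moreover have "finite D"
  proof -
    have "{s. Suc (nat \<bar>s\<bar>) = n} \<subseteq> {- int n..int n}" by auto
    then show ?thesis unfolding D_def by (meson finite_atLeastAtMost_int finite_imageI finite_subset)
  qed
  ultimately show ?thesis
    by (simp add: card_Un_disjoint)
qed

text \<open>From n = 2 on the counts are linear in n on each parity class, so multiplication by
  \<open>(1 - fps_X ^ 2) ^ 2\<close> leaves a polynomial.\<close>

lemma growth_series:
  fixes F :: "rat fps"
  assumes F: "\<And>n. fps_nth F n = of_nat (card (class_reps n))"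
  shows "F = (1 + fps_X) * (1 + 2 * fps_X + 3 * fps_X ^ 2 - fps_X ^ 3 - fps_X ^ 4)
              / (1 - fps_X ^ 2) ^ 2"
proof -
  \<comment> \<open>The bound 6 keeps \<open>n - 4\<close> away from the exceptional counts at 0 and
    1.\<close>
  have rec: "fps_nth F n = 2 * fps_nth F (n - 2) - fps_nth F (n - 4)" if "n \<ge> 6" for n
  proof -
    define m where "m = n - 6"
    then have "n = m + 6" using that by simp
    moreover have div: "(m + 6) div 2 = m div 2 + 3" "(4 + m) div 2 = m div 2 + 2"
      by presburger+
    ultimately show ?thesis
      unfolding F card_class_reps by (simp add: div)
  qed
  have "F * (1 - fps_X ^ 2) ^ 2 = F - 2 * (fps_X ^ 2 * F) + fps_X ^ 4 * F"
    by (simp add: power2_eq_square algebra_simps numeral_eq_Suc)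
  also have "\<dots> = (1 + fps_X) * (1 + 2 * fps_X + 3 * fps_X ^ 2 - fps_X ^ 3 - fps_X ^ 4)" (is "?l = ?r")
  proof (rule fps_ext)
    fix n :: nat
    have r: "?r = 1 + 3 * fps_X + 5 * fps_X ^ 2 + 2 * fps_X ^ 3 - 2 * fps_X ^ 4 - fps_X ^ 5"
      by (simp add: power2_eq_square algebra_simps numeral_eq_Suc)
    \<comment> \<open>Coefficients up to the degree 5 of the right side are compared one by one;
      beyond it \<open>rec\<close> makes those on the left vanish.\<close>
    consider "n \<in> {0, 1, 2, 3, 4, 5}" | "n \<ge> 6" by force
    then show "fps_nth ?l n = fps_nth ?r n"
    proof cases
      case 1
      then show ?thesis
        unfolding r by (elim insertE emptyE)
          (simp_all add: F card_class_reps numeral_fps_const fps_X_power_mult_nth)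
    next
      case 2
      then show ?thesis
        unfolding r using rec[OF 2] by (simp add: numeral_fps_const fps_X_power_mult_nth fps_X_power_nth)
    qed
  qed
  finally have "F * (1 - fps_X ^ 2) ^ 2 = (1 + fps_X) * (1 + 2 * fps_X + 3 * fps_X ^ 2 - fps_X ^ 3 - fps_X ^ 4)" .
  moreover have "fps_nth ((1 - fps_X ^ 2) ^ 2 :: rat fps) 0 = 1"
    by (simp add: fps_power_zeroth)
  then have "(1 - fps_X ^ 2) ^ 2 \<noteq> (0 :: rat fps)"
    by force
  ultimately show ?thesis
    by (metis nonzero_mult_div_cancel_right)
qed

theorem proposition5p1:
  shows "GG \<cong> semidirect_product (integer_group \<times>\<times> integer_group) (integer_mod_group 2) swap_action
    \<and> (\<forall>r. linear_order_on ZZ r \<longrightarrow> \<not> regular_language ZZ (ConjSL GG ZZ r))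
    \<and> (\<forall>r. linear_order_on ZZ r \<longrightarrow>
          spherical_conj_growth GG ZZ r =
            (1 + fps_X) * (1 + 2 * fps_X + 3 * fps_X ^ 2 - fps_X ^ 3 - fps_X ^ 4)
              / (1 - fps_X ^ 2) ^ 2)
    \<and> regular_language ZZ (ConjGeo GG ZZ)
    \<and> (\<forall>r. linear_order_on ZZ r \<longrightarrow> regular_language ZZ (ConjMinLenSL GG ZZ r))"
proof (intro conjI allI impI)
  show "regular_language ZZ (ConjGeo GG ZZ)"
    using regular_greedy_ConjGeo[of UNIV] by (simp add: greedy_UNIV)
next
  fix r assume r: "linear_order_on ZZ r"
  show "\<not> regular_language ZZ (ConjSL GG ZZ r)"
    using r by (rule ConjSL_not_regular)
  show "spherical_conj_growth GG ZZ r =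
            (1 + fps_X) * (1 + 2 * fps_X + 3 * fps_X ^ 2 - fps_X ^ 3 - fps_X ^ 4)
              / (1 - fps_X ^ 2) ^ 2"
    by (rule growth_series) (simp add: spherical_conj_growth_def card_ConjSL[OF r])
  show "regular_language ZZ (ConjMinLenSL GG ZZ r)"
    unfolding ConjMinLenSL_GG[OF r] by (rule regular_greedy_ConjGeo)
qed (rule GG_iso)

end
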